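(* Let $k\geq 2$ and let $\Phi$ be a $k$-vertex graph property that is fully symmetric and not $k$-trivial. Let $\ell\geq 2$ be maximal such that there is a prime $p$ with \[\binom{\ell}{2}+1\leq p\leq\binom{k}{2}+1.\] Then there is a $k$-vertex graph $H$ such that $\widehat{\Phi}(H)\neq 0$ and the complete graph $K_\ell$ is a subgraph of $H$.
   Context: All graphs are finite, simple and undirected. A $k$-vertex graph property is an isomorphism-invariant map $\Phi$ from graphs to $\{0,1\}$ with $\Phi(G)=0$ whenever $|V(G)|\neq k$. It is fully symmetric if $\Phi(G)=\Phi(G')$ for all $k$-vertex graphs with $|E(G)|=|E(G')|$, and $k$-trivial if constant on $k$-vertex graphs. The alternating enumerator is $\widehat{\Phi}(H)=(-1)^{|E(H)|}\sum_{S\subseteq E(H)}(-1)^{|S|}\Phi(H[S])$, where $H[S]=(V(H),S)$. *)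

theory Defs
  imports "HOL-Computational_Algebra.Primes"
begin

text \<open>
  A graph is a pair of a vertex set and an edge set, where an edge is a two-element set of vertices.
  The type also contains pairs that are not finite simple graphs; these are excluded by
  \<open>sgraph\<close>, to which every notion below is relativised.
\<close>

type_synonym 'a graph = "'a set \<times> 'a set set"

abbreviation verts :: "'a graph \<Rightarrow> 'a set" where
  "verts G \<equiv> fst G"

abbreviation edges :: "'a graph \<Rightarrow> 'a set set" where
  "edges G \<equiv> snd G"

definition sgraph :: "'a graph \<Rightarrow> bool" where
  "sgraph G \<longleftrightarrow> finite (verts G) \<and> (\<forall>e\<in>edges G. e \<subseteq> verts G \<and> card e = 2)"

definition vertex_graph :: "nat \<Rightarrow> 'a graph \<Rightarrow> bool" where
  "vertex_graph k G \<longleftrightarrow> sgraph G \<and> card (verts G) = k"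

definition graph_iso :: "'a graph \<Rightarrow> 'b graph \<Rightarrow> bool" where
  "graph_iso G G' \<longleftrightarrow>
     (\<exists>f. bij_betw f (verts G) (verts G') \<and>
          (\<forall>u\<in>verts G. \<forall>v\<in>verts G. {u, v} \<in> edges G \<longleftrightarrow> {f u, f v} \<in> edges G'))"

definition subgraph :: "'a graph \<Rightarrow> 'a graph \<Rightarrow> bool" where
  "subgraph G H \<longleftrightarrow> sgraph G \<and> sgraph H \<and> verts G \<subseteq> verts H \<and> edges G \<subseteq> edges H"

definition complete_graph :: "nat \<Rightarrow> nat graph" where
  "complete_graph l = ({..<l}, {e. e \<subseteq> {..<l} \<and> card e = 2})"

text \<open>As usual, being a subgraph is meant up to isomorphism for the abstract graph \<open>K\<^sub>l\<close>.\<close>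

definition contains_complete :: "nat \<Rightarrow> 'a graph \<Rightarrow> bool" where
  "contains_complete l H \<longleftrightarrow> (\<exists>G. subgraph G H \<and> graph_iso (complete_graph l) G)"

definition graph_property :: "nat \<Rightarrow> ('a graph \<Rightarrow> int) \<Rightarrow> bool" where
  "graph_property k \<Phi> \<longleftrightarrow>
     (\<forall>G. sgraph G \<longrightarrow> \<Phi> G \<in> {0, 1}) \<and>
     (\<forall>G G'. sgraph G \<and> sgraph G' \<and> graph_iso G G' \<longrightarrow> \<Phi> G = \<Phi> G') \<and>
     (\<forall>G. sgraph G \<and> card (verts G) \<noteq> k \<longrightarrow> \<Phi> G = 0)"

definition fully_symmetric :: "nat \<Rightarrow> ('a graph \<Rightarrow> int) \<Rightarrow> bool" where
  "fully_symmetric k \<Phi> \<longleftrightarrow>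
     (\<forall>G G'. vertex_graph k G \<and> vertex_graph k G' \<and> card (edges G) = card (edges G')
        \<longrightarrow> \<Phi> G = \<Phi> G')"

definition trivial_property :: "nat \<Rightarrow> ('a graph \<Rightarrow> int) \<Rightarrow> bool" where
  "trivial_property k \<Phi> \<longleftrightarrow>
     (\<forall>G G'. vertex_graph k G \<and> vertex_graph k G' \<longrightarrow> \<Phi> G = \<Phi> G')"

definition alternating_enumerator :: "('a graph \<Rightarrow> int) \<Rightarrow> 'a graph \<Rightarrow> int" where
  "alternating_enumerator \<Phi> H =
     (-1) ^ card (edges H) * (\<Sum>S\<in>Pow (edges H). (-1) ^ card S * \<Phi> (verts H, S))"

end

theory Submission
  imports Defs
begin

text \<open>
  By full symmetry, \<open>\<Phi>\<close> is a 0/1-valued function \<open>f\<close> of the number of edges, and up to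
  sign the alternating enumerator of a graph with \<open>m\<close> edges is the \<open>m\<close>-th finite difference of
  \<open>f\<close> at 0. If it vanished for all \<open>m\<close> between \<open>p - 1\<close> and \<open>N = k choose 2\<close>, then, by
  Pascal's rule, so would every \<open>(p - 1)\<close>-st difference of \<open>f\<close> inside \<open>{0..N}\<close>. As
  \<open>(p - 1) choose i\<close> is congruent to \<open>(-1) ^ i\<close> modulo \<open>p\<close>, the sum of \<open>f\<close> over any \<open>p\<close>
  consecutive points would be divisible by \<open>p\<close>, so \<open>f\<close> would be constant on each such window
  and hence on \<open>{0..N}\<close>. Thus some \<open>m\<close> with \<open>l choose 2 \<le> p - 1 \<le> m \<le> N\<close> has a nonzero
  difference, and any graph with \<open>m\<close> edges that contains a complete graph on \<open>l\<close> vertices will do.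
\<close>

section \<open>Alternating differences and windows of prime length\<close>

definition alt_diff :: "(nat \<Rightarrow> int) \<Rightarrow> nat \<Rightarrow> nat \<Rightarrow> int" where
  "alt_diff f m j = (\<Sum>i\<le>m. (-1) ^ i * int (m choose i) * f (j + i))"

text \<open>Pascal's rule, applied once the term for \<open>i = 0\<close> is split off.\<close>

lemma alt_diff_Suc: "alt_diff f (Suc m) j = alt_diff f m j - alt_diff f m (Suc j)"
proof -
  have "alt_diff f (Suc m) j =
      f j + (\<Sum>i\<le>m. (-1) ^ Suc i * int (Suc m choose Suc i) * f (j + Suc i))"
    unfolding alt_diff_def by (subst sum.atMost_Suc_shift) simp
  also have "\<dots> = f j + (\<Sum>i\<le>m. (-1) ^ Suc i * int (m choose Suc i) * f (j + Suc i))
      - alt_diff f m (Suc j)"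
    unfolding alt_diff_def
    by (simp add: algebra_simps flip: sum.distrib sum_subtractf sum_negf)
  also have "f j + (\<Sum>i\<le>m. (-1) ^ Suc i * int (m choose Suc i) * f (j + Suc i))
      = (\<Sum>i\<le>Suc m. (-1) ^ i * int (m choose i) * f (j + i))"
    by (subst sum.atMost_Suc_shift) simp
  \<comment> \<open>The extra top term vanishes because \<open>m choose Suc m\<close> is 0.\<close>
  also have "\<dots> = alt_diff f m j"
    unfolding alt_diff_def by simp
  finally show ?thesis .
qed

text \<open>The recurrence trades a step of the base point for a step of the order: orders
  \<open>m\<close> and \<open>Suc m\<close> at \<open>j\<close> determine order \<open>m\<close> at
  \<open>Suc j\<close>, and \<open>m + j\<close> never exceeds \<open>N\<close>.\<close>

lemma alt_diff_shift_eq_0: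
  assumes "\<And>m. a \<le> m \<Longrightarrow> m \<le> N \<Longrightarrow> alt_diff f m 0 = 0"
    and "a \<le> m" and "m + j \<le> N"
  shows "alt_diff f m j = 0"
  using assms(2,3)
proof (induction j arbitrary: m)
  case 0
  then show ?case using assms(1) by simp
next
  case (Suc j)
  then have "alt_diff f m j = 0" "alt_diff f (Suc m) j = 0"
    by simp_all
  then show ?case using alt_diff_Suc[of f m j] by simp
qed

text \<open>Neighbours in row \<open>p - 1\<close> of Pascal's triangle add up to
  \<open>p choose Suc i\<close>, a multiple of \<open>p\<close>, so modulo \<open>p\<close> the
  entries alternate in sign, starting from 1.\<close>

lemma prime_dvd_choose_pred_diff:
  assumes "prime p" and "i < p"
  shows "int p dvd int ((p - 1) choose i) - (-1) ^ i"
  using assms(2)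
proof (induction i)
  case 0
  then show ?case by simp
next
  case (Suc i)
  have "p choose Suc i = ((p - 1) choose i) + ((p - 1) choose Suc i)"
    using Suc.prems by (cases p) auto
  moreover have "int p dvd int (p choose Suc i)"
    using dvd_choose_prime[of "Suc i" p] Suc.prems assms(1) by simp
  ultimately have "int p dvd int ((p - 1) choose i) + int ((p - 1) choose Suc i)"
    by simp
  moreover have "int p dvd int ((p - 1) choose i) - (-1) ^ i"
    using Suc by simp
  ultimately have "int p dvd (int ((p - 1) choose i) + int ((p - 1) choose Suc i))
      - (int ((p - 1) choose i) - (-1) ^ i)"
    by (rule dvd_diff)
  then show ?case by simp
qed

lemma prime_dvd_window_sum:
  assumes "prime p" and "alt_diff f (p - 1) j = 0"
  shows "int p dvd (\<Sum>i<p. f (j + i))"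
proof -
  have p: "{..p - 1} = {..<p}"
    using prime_gt_0_nat[OF assms(1)] by auto
  \<comment> \<open>The weight \<open>(-1) ^ i\<close> cancels the sign in the congruence, leaving
    the unsigned sum of \<open>f\<close>.\<close>
  have "int p dvd (\<Sum>i<p. (-1) ^ i * (int ((p - 1) choose i) - (-1) ^ i) * f (j + i))"
    using prime_dvd_choose_pred_diff[OF assms(1)] by (intro dvd_sum) simp
  also have "\<dots> = alt_diff f (p - 1) j - (\<Sum>i<p. f (j + i))"
    unfolding alt_diff_def p
    by (simp add: left_diff_distrib right_diff_distrib sum_subtractf mult.assoc
        flip: power_mult_distrib)
  finally show ?thesis using assms(2) by simp
qed

text \<open>The sum lies between 0 and \<open>p\<close>, so divisibility forces one of the two
  extremes: all values are 0 or all are 1.\<close>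

lemma window_const:
  fixes f :: "nat \<Rightarrow> int"
  assumes "\<And>i. i < p \<Longrightarrow> f (j + i) \<in> {0, 1}"
    and "int p dvd (\<Sum>i<p. f (j + i))"
    and "i < p"
  shows "f (j + i) = f j"
proof -
  let ?s = "\<Sum>i<p. f (j + i)"
  have bounds: "0 \<le> f (j + i) \<and> f (j + i) \<le> 1" if "i < p" for i
    using assms(1)[OF that] by auto
  have all_eq: "\<And>i. i < p \<Longrightarrow> f (j + i) = 0" if "?s = 0"
    using that bounds by (subst (asm) sum_nonneg_eq_0_iff) auto
  have compl: "(\<Sum>i<p. 1 - f (j + i)) = int p - ?s"
    by (simp add: sum_subtractf)
  have all_one: "\<And>i. i < p \<Longrightarrow> f (j + i) = 1" if "?s = int p"
    using that compl bounds sum_nonneg_eq_0_iff[of "{..<p}" "\<lambda>i. 1 - f (j + i)"] by auto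
  have "0 \<le> ?s"
    using bounds by (intro sum_nonneg) auto
  moreover have "0 \<le> (\<Sum>i<p. 1 - f (j + i))"
    using bounds by (intro sum_nonneg) auto
  ultimately have "?s = 0 \<or> ?s = int p"
    using assms(2) compl zdvd_imp_le[of "int p" ?s] by linarith
  then show ?thesis
  proof
    assume "?s = 0"
    then show ?thesis using all_eq[of i] all_eq[of 0] assms(3) by simp
  next
    assume "?s = int p"
    then show ?thesis using all_one[of i] all_one[of 0] assms(3) by simp
  qed
qed

lemma exists_alt_diff_nonzero:
  fixes f :: "nat \<Rightarrow> int"
  assumes "prime p" and "p \<le> N + 1"
    and range: "\<And>i. i \<le> N \<Longrightarrow> f i \<in> {0, 1}"
    and "a \<le> N" "b \<le> N" "f a \<noteq> f b"
  shows "\<exists>m. p - 1 \<le> m \<and> m \<le> N \<and> alt_diff f m 0 \<noteq> 0"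
proof (rule ccontr)
  assume "\<not> ?thesis"
  then have zero: "\<And>m. p - 1 \<le> m \<Longrightarrow> m \<le> N \<Longrightarrow> alt_diff f m 0 = 0"
    by blast
  have p: "p \<ge> 2"
    using assms(1) by (rule prime_ge_2_nat)
  have window: "f (j + i) = f j" if "j + p \<le> N + 1" "i < p" for i j
  proof (rule window_const)
    have "alt_diff f (p - 1) j = 0"
      using that p by (intro alt_diff_shift_eq_0[OF zero]) auto
    then show "int p dvd (\<Sum>i<p. f (j + i))"
      by (rule prime_dvd_window_sum[OF assms(1)])
    show "f (j + i) \<in> {0, 1}" if "i < p" for i
      using range[of "j + i"] that \<open>j + p \<le> N + 1\<close> by simp
  qed (use that in simp)
  have const: "f n = f 0" if "n \<le> N" for n
    using that
  proof (induction n)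
    case (Suc n)
    show ?case
    proof (cases "Suc n < p")
      case True
      then show ?thesis using window[of 0 "Suc n"] assms(2) by simp
    next
      case False
      \<comment> \<open>The window ending at \<open>Suc n\<close>; since \<open>p \<ge> 2\<close> it
        also contains \<open>n\<close>.\<close>
      let ?j = "Suc n - (p - 1)"
      have "f (?j + (p - 1)) = f ?j" "f (?j + (p - 2)) = f ?j"
        by (rule window; use False Suc.prems p in linarith)+
      moreover have "?j + (p - 1) = Suc n" "?j + (p - 2) = n"
        using False p by simp_all
      ultimately show ?thesis using Suc by simp
    qed
  qed simp
  show False
    using const[OF assms(4)] const[OF assms(5)] assms(6) by simp
qed

section \<open>Edge counts and the alternating enumerator\<close>

lemma card_two_subsets:
  assumes "finite V"
  shows "card {e. e \<subseteq> V \<and> card e = 2} = card V choose 2"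
    and "finite {e. e \<subseteq> V \<and> card e = 2}"
  using assms by (simp_all add: n_subsets)

lemma vertex_graph_iff:
  "vertex_graph k (V, E) \<longleftrightarrow>
     finite V \<and> card V = k \<and> E \<subseteq> {e. e \<subseteq> V \<and> card e = 2}"
  unfolding vertex_graph_def sgraph_def by auto

lemma vertex_graph_card_edges_le:
  assumes "vertex_graph k G"
  shows "card (edges G) \<le> k choose 2"
proof -
  have "finite (verts G)" "card (verts G) = k" "edges G \<subseteq> {e. e \<subseteq> verts G \<and> card e = 2}"
    using assms unfolding vertex_graph_def sgraph_def by auto
  then show ?thesis
    using card_mono[of "{e. e \<subseteq> verts G \<and> card e = 2}" "edges G"]
    by (simp add: card_two_subsets)
qed

lemma sum_Pow_card:
  fixes g :: "nat \<Rightarrow> int"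
  assumes "finite E"
  shows "(\<Sum>S\<in>Pow E. g (card S)) = (\<Sum>i\<le>card E. int (card E choose i) * g i)"
proof -
  have "(\<Sum>S\<in>Pow E. g (card S))
      = (\<Sum>i\<le>card E. \<Sum>S\<in>{S \<in> Pow E. card S = i}. g (card S))"
    using assms by (intro sum.group[symmetric]) (auto intro: card_mono)
  also have "\<dots> = (\<Sum>i\<le>card E. int (card {S. S \<subseteq> E \<and> card S = i}) * g i)"
    by (intro sum.cong) auto
  finally show ?thesis using assms by (simp add: n_subsets)
qed

text \<open>Deleting edges keeps the vertex set, so each \<open>(verts H, S)\<close> is again a
  \<open>k\<close>-vertex graph and \<Phi> sees only \<open>card S\<close>.\<close>

lemma alternating_enumerator_eq_alt_diff:
  assumes "vertex_graph k H"
    and f: "\<And>G. vertex_graph k G \<Longrightarrow> \<Phi> G = f (card (edges G))"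
  shows "alternating_enumerator \<Phi> H =
    (-1) ^ card (edges H) * alt_diff f (card (edges H)) 0"
proof -
  have H: "finite (verts H)" "edges H \<subseteq> {e. e \<subseteq> verts H \<and> card e = 2}"
    and sub: "\<And>S. S \<subseteq> edges H \<Longrightarrow> vertex_graph k (verts H, S)"
    using assms(1) unfolding vertex_graph_def sgraph_def by auto
  have fin: "finite (edges H)"
    using H card_two_subsets(2) finite_subset by blast
  have "(\<Sum>S\<in>Pow (edges H). (-1) ^ card S * \<Phi> (verts H, S))
      = (\<Sum>S\<in>Pow (edges H). (-1) ^ card S * f (card S))"
    using f[OF sub] by (intro sum.cong) auto
  also have "\<dots> = alt_diff f (card (edges H)) 0"
    unfolding alt_diff_def sum_Pow_card[OF fin, of "\<lambda>i. (-1) ^ i * f i"]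
    by (simp add: ac_simps)
  finally show ?thesis by (simp add: alternating_enumerator_def)
qed

lemma graph_iso_complete_graph:
  assumes "finite W" and "card W = l"
  shows "graph_iso (complete_graph l) (W, {e. e \<subseteq> W \<and> card e = 2})"
proof -
  obtain g where g: "bij_betw g {..<l} W"
    using assms finite_same_card_bij[of "{..<l}" W] by auto
  have "{u, v} \<in> {e. e \<subseteq> {..<l} \<and> card e = 2} \<longleftrightarrow>
      {g u, g v} \<in> {e. e \<subseteq> W \<and> card e = 2}" if "u < l" "v < l" for u v
  proof -
    have "g u = g v \<longleftrightarrow> u = v" "g u \<in> W" "g v \<in> W"
      using g that by (auto simp: bij_betw_def inj_on_def)
    then show ?thesis using that by (auto simp: card_insert_if)
  qed
  then show ?thesis
    using g unfolding graph_iso_def complete_graph_def by auto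
qed

text \<open>The edge set is interpolated between all pairs in an \<open>l\<close>-subset of
  \<open>V\<close> and all pairs in \<open>V\<close>. The set \<open>V\<close> is given because the
  type \<open>'a\<close> may be too small to have \<open>k\<close> elements.\<close>

lemma exists_vertex_graph_containing_complete:
  fixes V :: "'a set"
  assumes "finite V" "card V = k" "l \<le> k" "l choose 2 \<le> m" "m \<le> k choose 2"
  shows "\<exists>H :: 'a graph. vertex_graph k H \<and> card (edges H) = m \<and> contains_complete l H"
proof -
  let ?P = "\<lambda>W. {e. e \<subseteq> W \<and> card e = 2}"
  obtain W where W: "W \<subseteq> V" "card W = l" "finite W"
    using obtain_subset_with_card_n[of l V] assms by metis
  have "?P W \<subseteq> ?P V"
    using W(1) by auto
  moreover have "card (?P W) \<le> m" "m \<le> card (?P V)"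
    using assms W by (simp_all add: card_two_subsets(1))
  ultimately obtain E where E: "?P W \<subseteq> E" "E \<subseteq> ?P V" "card E = m"
    using exists_subset_between card_two_subsets(2)[OF assms(1)] by meson
  have "vertex_graph k (V, E)"
    using E assms by (simp add: vertex_graph_iff)
  moreover have "subgraph (W, ?P W) (V, E)"
    using W E assms(1) unfolding subgraph_def sgraph_def by auto
  then have "contains_complete l (V, E)"
    unfolding contains_complete_def using graph_iso_complete_graph[OF W(3,2)] by blast
  ultimately show ?thesis using E(3) by auto
qed

lemma choose_two_less:
  fixes k l :: nat
  assumes "k > 0" and "k < l"
  shows "k choose 2 < l choose 2"
proof -
  have "k choose 2 < Suc k choose 2"
    using assms(1) by (simp add: numeral_2_eq_2)
  also have "\<dots> \<le> l choose 2"
    using assms(2) by (intro binomial_right_mono) simp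
  finally show ?thesis .
qed

theorem theorem5p11:
  fixes k l :: nat and \<Phi> :: "'a graph \<Rightarrow> int"
  assumes "k \<ge> 2"
    and "graph_property k \<Phi>"
    and "fully_symmetric k \<Phi>"
    and "\<not> trivial_property k \<Phi>"
    and "l \<ge> 2"
    and "\<exists>p::nat. prime p \<and> (l choose 2) + 1 \<le> p \<and> p \<le> (k choose 2) + 1"
    and "\<And>m::nat. m \<ge> 2 \<Longrightarrow>
           \<exists>p::nat. prime p \<and> (m choose 2) + 1 \<le> p \<and> p \<le> (k choose 2) + 1 \<Longrightarrow> m \<le> l"
  shows "\<exists>H. vertex_graph k H \<and> alternating_enumerator \<Phi> H \<noteq> 0 \<and> contains_complete l H"
proof -
  obtain p where p: "prime p" "(l choose 2) + 1 \<le> p" "p \<le> (k choose 2) + 1"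
    using assms(6) by blast
  \<comment> \<open>Otherwise \<open>l choose 2\<close> would exceed \<open>k choose 2\<close>,
    leaving no room for \<open>p\<close>.\<close>
  have "l \<le> k"
    using choose_two_less[of k l] assms(1) p by force
  obtain A B where AB: "vertex_graph k A" "vertex_graph k B" "\<Phi> A \<noteq> \<Phi> B"
    using assms(4) unfolding trivial_property_def by blast
  \<comment> \<open>A witness of non-triviality supplies the \<open>k\<close> vertices.\<close>
  have V: "finite (verts A)" "card (verts A) = k"
    using AB(1) by (auto simp: vertex_graph_def sgraph_def)
  \<comment> \<open>For \<open>i\<close> above \<open>k choose 2\<close> no such graph exists and
    the value is arbitrary; only smaller arguments matter below.\<close>
  define f where "f i = \<Phi> (SOME G. vertex_graph k G \<and> card (edges G) = i)" for i
  have f: "\<Phi> G = f (card (edges G))" if "vertex_graph k G" for G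
  proof -
    let ?G = "SOME G' :: 'a graph. vertex_graph k G' \<and> card (edges G') = card (edges G)"
    have "\<exists>G' :: 'a graph. vertex_graph k G' \<and> card (edges G') = card (edges G)"
      using that by blast
    then have "vertex_graph k ?G \<and> card (edges ?G) = card (edges G)"
      by (rule someI_ex)
    then have "\<Phi> G = \<Phi> ?G"
      using that assms(3)[unfolded fully_symmetric_def, rule_format, of G ?G] by simp
    then show ?thesis
      by (simp only: f_def)
  qed
  have "f i \<in> {0, 1}" if i: "i \<le> k choose 2" for i
  proof -
    obtain G :: "'a graph" where "vertex_graph k G" "card (edges G) = i"
      \<comment> \<open>With \<open>l = 0\<close> the clique condition is vacuous, so this just
        provides a graph with \<open>i\<close> edges.\<close>
      using exists_vertex_graph_containing_complete[OF V, of 0 i] i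
      by (auto simp: binomial_eq_0)
    moreover have "\<Phi> G \<in> {0, 1}"
      using \<open>vertex_graph k G\<close> assms(2) unfolding graph_property_def vertex_graph_def by blast
    ultimately show ?thesis
      using f[of G] by simp
  qed
  moreover have "f (card (edges A)) \<noteq> f (card (edges B))"
    using AB f by simp
  ultimately obtain m where m: "p - 1 \<le> m" "m \<le> k choose 2" "alt_diff f m 0 \<noteq> 0"
    using exists_alt_diff_nonzero[OF p(1,3), of f "card (edges A)" "card (edges B)"]
      AB(1,2)[THEN vertex_graph_card_edges_le] by blast
  have "l choose 2 \<le> m"
    using m(1) p(2) by linarith
  then obtain H :: "'a graph"
    where H: "vertex_graph k H" "card (edges H) = m" "contains_complete l H"
    using exists_vertex_graph_containing_complete[OF V \<open>l \<le> k\<close>, of m] m(2) by blast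
  have "alternating_enumerator \<Phi> H \<noteq> 0"
    using alternating_enumerator_eq_alt_diff[where f = f, OF H(1) f] H(2) m(3) by simp
  then show ?thesis
    using H by blast
qed

end
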